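(* Let $F$ be a field of characteristic $\neq 2$. The dimension over $F$ of $\mathfrak{P}_{r,s}$ is given as follows. 1) If $r\ge 3$ and $s\ge 3$, then $\dim\mathfrak{P}_{r,s}=2^{r+s-2}+2^{\frac{r+s-1}{2}}\sin\left(\frac{(r+1)\pi}{4}\right)\sin\left(\frac{s\pi}{4}\right)$. 2) If $r\ge 3$, then a) $\dim\mathfrak{P}_{r,1}=2^{r-1}+2^{\frac{r-1}{2}}\sin\left(\frac{(r+1)\pi}{4}\right)$; b) $\dim\mathfrak{P}_{r,2}=2^{r}+2^{\frac{r+1}{2}}\sin\left(\frac{(r+1)\pi}{4}\right)$. 3) If $s\ge 3$, then a) $\dim\mathfrak{P}_{1,s}=2^{s-1}+2^{\frac{s}{2}}\sin\left(\frac{s\pi}{4}\right)$; b) $\dim\mathfrak{P}_{2,s}=2^{s}+2^{\frac{s}{2}}\sin\left(\frac{s\pi}{4}\right)$. 4) $\dim\mathfrak{P}_{1,1}=2$, $\dim\mathfrak{P}_{1,2}=4$, $\dim\mathfrak{P}_{2,1}=3$, $\dim\mathfrak{P}_{2,2}=6$.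
   Context: Let $n=r+s$, let $e_1,\dots,e_n$ be the canonical basis of $F^n$, and let $Q$ be the symmetric bilinear form on $F^n$ with $Q(e_i,e_j)=0$ for $i\ne j$, $Q(e_i,e_i)=1$ for $1\le i\le r$, $Q(e_i,e_i)=-1$ for $r+1\le i\le r+s$. $C\ell(r,s)$ is the Clifford algebra over $F$ of $(F^n,Q)$, with sign convention $v\cdot v=-Q(v,v)1$. Let $c$ be the unique algebra anti-automorphism of $C\ell(r,s)$ with $c(v)=-v$ for $v\in F^n$, and let $\mathfrak{G}_{r,s}=\{\varphi\in C\ell(r,s):c(\varphi)=-\varphi\}$. Let $\beta$ be the algebra automorphism of $C\ell(r,s)$ with $\beta(e_i)=e_i$ for $1\le i\le r$ and $\beta(e_{r+j})=-e_{r+j}$ for $1\le j\le s$; it leaves $\mathfrak{G}_{r,s}$ invariant. $\mathfrak{P}_{r,s}$ is the $-1$ eigenspace of $\beta$ restricted to $\mathfrak{G}_{r,s}$. *)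

theory Defs
  imports "HOL-Analysis.Analysis" "HOL-Library.Poly_Mapping"
begin


section \<open>The quadratic space\<close>

text \<open>
  The space $F^n$ with $n = r + s$ is \<^typ>\<open>'a ^ ('r + 's)\<close>, where $F$ is the type \<^typ>\<open>'a\<close>,
  $r$ is the cardinality of \<^typ>\<open>'r\<close> and $s$ that of \<^typ>\<open>'s\<close>.  The first $r$ basis vectors are
  indexed by the left summand, the last $s$ by the right one.  Index types are nonempty, so this
  covers exactly the pairs with $r, s \<ge> 1$.
\<close>

definition pos_basis :: "'r::finite \<Rightarrow> 'a::field ^ ('r + 's::finite)" where
  "pos_basis i = axis (Inl i) 1"

definition neg_basis :: "'s::finite \<Rightarrow> 'a::field ^ ('r::finite + 's)" where
  "neg_basis j = axis (Inr j) 1"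

definition Q_form :: "'a::field ^ ('r::finite + 's::finite) \<Rightarrow> 'a ^ ('r + 's) \<Rightarrow> 'a" where
  "Q_form x y = (\<Sum>i\<in>UNIV. x $ Inl i * y $ Inl i) - (\<Sum>j\<in>UNIV. x $ Inr j * y $ Inr j)"

lemma sum_mult_if:
  fixes f :: "'i::finite \<Rightarrow> 'a::field"
  shows "(\<Sum>i\<in>UNIV. (if i = k then 1 else 0) * f i) = f k"
    and "(\<Sum>i\<in>UNIV. (if k = i then 1 else 0) * f i) = f k"
proof -
  have "(\<Sum>i\<in>UNIV. (if i = k then 1 else 0) * f i) = (\<Sum>i\<in>UNIV. if i = k then f i else 0)"
    by (rule sum.cong) auto
  then show "(\<Sum>i\<in>UNIV. (if i = k then 1 else 0) * f i) = f k" by simp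
  have "(\<Sum>i\<in>UNIV. (if k = i then 1 else 0) * f i) = (\<Sum>i\<in>UNIV. if i = k then f i else 0)"
    by (rule sum.cong) auto
  then show "(\<Sum>i\<in>UNIV. (if k = i then 1 else 0) * f i) = f k" by simp
qed

lemma Q_form_basis:
  "Q_form (pos_basis i :: 'a::field ^ ('r::finite + 's::finite)) (pos_basis i') = (if i = i' then 1 else 0)"
  "Q_form (neg_basis j :: 'a ^ ('r + 's)) (neg_basis j') = (if j = j' then -1 else 0)"
  "Q_form (pos_basis i :: 'a ^ ('r + 's)) (neg_basis j) = 0"
  "Q_form (neg_basis j :: 'a ^ ('r + 's)) (pos_basis i) = 0"
  by (auto simp: Q_form_def pos_basis_def neg_basis_def axis_def sum_mult_if)

lemma Q_form_sym: "Q_form x y = Q_form y x"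
  by (simp add: Q_form_def mult.commute)

lemma Q_form_add: "Q_form (x + x') y = Q_form x y + Q_form x' y"
  by (simp add: Q_form_def algebra_simps sum.distrib)

lemma Q_form_scale: "Q_form (a *s x) y = a * Q_form x y"
  by (simp add: Q_form_def algebra_simps sum_distrib_left)


section \<open>The tensor algebra\<close>

text \<open>
  The tensor algebra of $F^n$, written in the basis of pure tensors
  $e_{i_1} \otimes \cdots \otimes e_{i_k}$: finitely supported coefficient functions on the words
  $i_1 \ldots i_k$.  The library multiplies such functions by convolution with respect to
  \<open>+\<close>, which is concatenation of words.
\<close>

datatype 'i tensor_word = Word (letters: "'i list")

instantiation tensor_word :: (type) monoid_add
begin

definition zero_tensor_word :: "'a tensor_word" where
  "0 = Word []"

definition plus_tensor_word :: "'a tensor_word \<Rightarrow> 'a tensor_word \<Rightarrow> 'a tensor_word" where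
  "u + w = Word (letters u @ letters w)"

instance
  by standard (auto simp: zero_tensor_word_def plus_tensor_word_def)

end

type_synonym ('i, 'a) tensor_algebra = "'i tensor_word \<Rightarrow>\<^sub>0 'a"

definition tensor_scalar :: "'a::field \<Rightarrow> ('i, 'a) tensor_algebra" where
  "tensor_scalar a = Poly_Mapping.single 0 a"

definition tensor_vec :: "'a::field ^ 'i::finite \<Rightarrow> ('i, 'a) tensor_algebra" where
  "tensor_vec v = (\<Sum>i\<in>UNIV. Poly_Mapping.single (Word [i]) (v $ i))"

lemma tensor_induct [case_names zero single add]:
  fixes p :: "'k \<Rightarrow>\<^sub>0 'a::comm_monoid_add"
  assumes "P 0" "\<And>w a. P (Poly_Mapping.single w a)" "\<And>p q. P p \<Longrightarrow> P q \<Longrightarrow> P (p + q)"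
  shows "P p"
proof (induction p rule: update_induct)
  case const
  show ?case by fact
next
  case (update f a b)
  have "Poly_Mapping.update a b f = f + Poly_Mapping.single a b"
    using update.hyps
    by (intro poly_mapping_eqI) (auto simp: lookup_update lookup_add lookup_single in_keys_iff when_def)
  then show ?case using assms update.IH by simp
qed

lemma tensor_scalar_simps:
  "tensor_scalar (a + b) = tensor_scalar a + tensor_scalar b"
  "tensor_scalar (a * b) = tensor_scalar a * tensor_scalar b"
  "tensor_scalar 1 = 1" "tensor_scalar 0 = 0"
  "tensor_scalar (- a) = - tensor_scalar a"
  by (simp_all add: tensor_scalar_def single_add mult_single single_uminus)

lemma tensor_scalar_central: "tensor_scalar a * p = p * tensor_scalar a"
  by (induction p rule: tensor_induct)
    (simp_all add: tensor_scalar_def mult_single mult.commute distrib_left distrib_right)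

lemma tensor_scalar_swap:
  "tensor_scalar a * p * (tensor_scalar b * q) = tensor_scalar (a * b) * (p * q)"
proof -
  have "tensor_scalar a * p * (tensor_scalar b * q) = tensor_scalar a * (p * tensor_scalar b) * q"
    by (simp only: mult.assoc)
  also have "\<dots> = tensor_scalar a * (tensor_scalar b * p) * q"
    by (simp only: tensor_scalar_central)
  also have "\<dots> = tensor_scalar (a * b) * (p * q)"
    by (simp only: tensor_scalar_simps mult.assoc)
  finally show ?thesis .
qed

lemma tensor_vec_axis:
  "tensor_vec (axis i 1 :: 'a::field ^ 'i::finite) = Poly_Mapping.single (Word [i]) 1"
proof -
  have "(\<Sum>j\<in>UNIV. Poly_Mapping.single (Word [j]) (axis i 1 $ j :: 'a))
      = (\<Sum>j\<in>UNIV. if j = i then Poly_Mapping.single (Word [j]) 1 else 0)"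
    by (rule sum.cong) (auto simp: axis_def)
  then show ?thesis by (simp add: tensor_vec_def)
qed

lemma tensor_vec_scaled: "tensor_vec (a *s v) = tensor_scalar a * tensor_vec v"
  by (simp add: tensor_vec_def tensor_scalar_def sum_distrib_left mult_single)

lemma tensor_vec_add: "tensor_vec (v + w) = tensor_vec v + tensor_vec w"
  by (simp add: tensor_vec_def single_add sum.distrib)


section \<open>The Clifford algebra\<close>

text \<open>
  The quotient of the tensor algebra by the two-sided ideal generated by the elements
  $v \<otimes> v + Q(v,v) 1$, that is, with the sign convention $v \<cdot> v = - Q(v,v) 1$.  It is not made an
  instance of \<open>ring_1\<close>, since that class also demands $0 \<noteq> 1$, which requires a proof that the
  ideal is proper.
\<close>

definition two_sided_ideal :: "'b::ring set \<Rightarrow> bool" where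
  "two_sided_ideal I \<longleftrightarrow> 0 \<in> I \<and> (\<forall>x\<in>I. \<forall>y\<in>I. x + y \<in> I) \<and> (\<forall>x\<in>I. - x \<in> I) \<and>
     (\<forall>x\<in>I. \<forall>a. a * x \<in> I \<and> x * a \<in> I)"

text \<open>Sign convention $v \cdot v = - Q(v,v) 1$.\<close>

definition clifford_ideal :: "('r::finite + 's::finite, 'a::field) tensor_algebra set" where
  "clifford_ideal =
     two_sided_ideal hull {tensor_vec v * tensor_vec v + tensor_scalar (Q_form v v) | v. True}"

definition clifford_rel ::
  "('r::finite + 's::finite, 'a::field) tensor_algebra \<Rightarrow> ('r + 's, 'a) tensor_algebra \<Rightarrow> bool" where
  "clifford_rel x y \<longleftrightarrow> x - y \<in> clifford_ideal"

lemma two_sided_ideal_clifford_ideal: "two_sided_ideal clifford_ideal"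
  unfolding clifford_ideal_def by (rule hull_in) (auto simp: two_sided_ideal_def)

lemma clifford_ideal_gen:
  "tensor_vec v * tensor_vec v + tensor_scalar (Q_form v v) \<in> clifford_ideal"
  unfolding clifford_ideal_def by (rule hull_inc) blast

lemma clifford_ideal_closed:
  "0 \<in> clifford_ideal"
  "x \<in> clifford_ideal \<Longrightarrow> y \<in> clifford_ideal \<Longrightarrow> x + y \<in> clifford_ideal"
  "x \<in> clifford_ideal \<Longrightarrow> - x \<in> clifford_ideal"
  "x \<in> clifford_ideal \<Longrightarrow> a * x \<in> clifford_ideal"
  "x \<in> clifford_ideal \<Longrightarrow> x * a \<in> clifford_ideal"
  using two_sided_ideal_clifford_ideal by (auto simp: two_sided_ideal_def)

lemma equivp_clifford_rel:
  "equivp (clifford_rel :: ('r::finite + 's::finite, 'a::field) tensor_algebra \<Rightarrow> _)"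
proof (rule equivpI)
  show "reflp (clifford_rel :: ('r + 's, 'a) tensor_algebra \<Rightarrow> _)"
    by (simp add: reflp_def clifford_rel_def clifford_ideal_closed)
  show "symp (clifford_rel :: ('r + 's, 'a) tensor_algebra \<Rightarrow> _)"
    unfolding symp_def clifford_rel_def using clifford_ideal_closed(3) by fastforce
  show "transp (clifford_rel :: ('r + 's, 'a) tensor_algebra \<Rightarrow> _)"
  proof (rule transpI)
    fix x y z :: "('r + 's, 'a) tensor_algebra"
    assume "clifford_rel x y" "clifford_rel y z"
    then have "(x - y) + (y - z) \<in> clifford_ideal"
      unfolding clifford_rel_def by (rule clifford_ideal_closed(2))
    then show "clifford_rel x z" by (simp add: clifford_rel_def)
  qed
qed

quotient_type (overloaded) ('a, 'r, 's) clifford =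
  "('r::finite + 's::finite, 'a::field) tensor_algebra" / clifford_rel
  by (rule equivp_clifford_rel)

instantiation clifford :: (field, finite, finite) "{ring, monoid_mult}"
begin

lift_definition zero_clifford :: "('a, 'b, 'c) clifford" is 0 .
lift_definition one_clifford :: "('a, 'b, 'c) clifford" is 1 .

lift_definition plus_clifford ::
  "('a, 'b, 'c) clifford \<Rightarrow> ('a, 'b, 'c) clifford \<Rightarrow> ('a, 'b, 'c) clifford" is "(+)"
proof -
  fix x x' y y' :: "('b + 'c, 'a) tensor_algebra"
  assume "clifford_rel x x'" "clifford_rel y y'"
  then have "(x - x') + (y - y') \<in> clifford_ideal"
    unfolding clifford_rel_def by (rule clifford_ideal_closed(2))
  then show "clifford_rel (x + y) (x' + y')"
    by (simp add: clifford_rel_def algebra_simps)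
qed

lift_definition uminus_clifford :: "('a, 'b, 'c) clifford \<Rightarrow> ('a, 'b, 'c) clifford" is uminus
proof -
  fix x x' :: "('b + 'c, 'a) tensor_algebra"
  assume "clifford_rel x x'"
  then have "- (x - x') \<in> clifford_ideal"
    unfolding clifford_rel_def by (rule clifford_ideal_closed(3))
  then show "clifford_rel (- x) (- x')"
    by (simp add: clifford_rel_def)
qed

definition minus_clifford ::
  "('a, 'b, 'c) clifford \<Rightarrow> ('a, 'b, 'c) clifford \<Rightarrow> ('a, 'b, 'c) clifford" where
  "x - y = x + - (y :: ('a, 'b, 'c) clifford)"

lift_definition times_clifford ::
  "('a, 'b, 'c) clifford \<Rightarrow> ('a, 'b, 'c) clifford \<Rightarrow> ('a, 'b, 'c) clifford" is "(*)"
proof -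
  fix x x' y y' :: "('b + 'c, 'a) tensor_algebra"
  assume "clifford_rel x x'" "clifford_rel y y'"
  then have "(x - x') * y + x' * (y - y') \<in> clifford_ideal"
    unfolding clifford_rel_def by (intro clifford_ideal_closed)
  then show "clifford_rel (x * y) (x' * y')"
    by (simp add: clifford_rel_def algebra_simps)
qed

instance
proof
  fix x y z :: "('a, 'b, 'c) clifford"
  show "x + y + z = x + (y + z)"
    by transfer (simp add: add.assoc clifford_rel_def clifford_ideal_closed(1))
  show "x + y = y + x"
    by transfer (simp add: add.commute clifford_rel_def clifford_ideal_closed(1))
  show "0 + x = x"
    by transfer (simp add: clifford_rel_def clifford_ideal_closed(1))
  show "- x + x = 0"
    by transfer (simp add: clifford_rel_def clifford_ideal_closed(1))
  show "x - y = x + - y"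
    by (rule minus_clifford_def)
  show "x * y * z = x * (y * z)"
    by transfer (simp add: mult.assoc clifford_rel_def clifford_ideal_closed(1))
  show "(x + y) * z = x * z + y * z"
    by transfer (simp add: distrib_right clifford_rel_def clifford_ideal_closed(1))
  show "x * (y + z) = x * y + x * z"
    by transfer (simp add: distrib_left clifford_rel_def clifford_ideal_closed(1))
  show "1 * x = x"
    by transfer (simp add: clifford_rel_def clifford_ideal_closed(1))
  show "x * 1 = x"
    by transfer (simp add: clifford_rel_def clifford_ideal_closed(1))
qed

end

lift_definition clifford_scale ::
  "'a::field \<Rightarrow> ('a, 'r::finite, 's::finite) clifford \<Rightarrow> ('a, 'r, 's) clifford"
  is "\<lambda>a x. tensor_scalar a * x"
proof -
  fix a :: 'a and x x' :: "('r + 's, 'a) tensor_algebra"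
  assume "clifford_rel x x'"
  then have "tensor_scalar a * (x - x') \<in> clifford_ideal"
    unfolding clifford_rel_def by (rule clifford_ideal_closed(4))
  then show "clifford_rel (tensor_scalar a * x) (tensor_scalar a * x')"
    by (simp add: clifford_rel_def right_diff_distrib)
qed

lift_definition clifford_vec ::
  "'a::field ^ ('r::finite + 's::finite) \<Rightarrow> ('a, 'r, 's) clifford" is tensor_vec .

lemma vector_space_clifford_scale:
  "vector_space (clifford_scale :: 'a::field \<Rightarrow> ('a, 'r::finite, 's::finite) clifford \<Rightarrow> _)"
  by standard
    (transfer, simp add: algebra_simps tensor_scalar_simps clifford_rel_def clifford_ideal_closed(1))+

lemma clifford_scale_mult:
  "clifford_scale a x * y = clifford_scale a (x * y)"
  "x * clifford_scale a y = clifford_scale a (x * y)"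
proof -
  show "clifford_scale a x * y = clifford_scale a (x * y)"
    by transfer (simp add: mult.assoc clifford_rel_def clifford_ideal_closed(1))
  show "x * clifford_scale a y = clifford_scale a (x * y)"
    by transfer (simp add: mult.assoc tensor_scalar_central clifford_rel_def
        clifford_ideal_closed(1))
qed

lemma clifford_vec_square: "clifford_vec v * clifford_vec v = clifford_scale (- Q_form v v) 1"
  by transfer (use clifford_ideal_gen in \<open>simp add: clifford_rel_def tensor_scalar_simps\<close>)

lemma linear_clifford_vec:
  "Vector_Spaces.linear (*s) clifford_scale
     (clifford_vec :: 'a::field ^ ('r::finite + 's::finite) \<Rightarrow> ('a, 'r, 's) clifford)"
proof (intro Vector_Spaces.linear.intro module_hom.intro module_hom_axioms.intro)
  show "vector_space ((*s) :: 'a \<Rightarrow> 'a ^ ('r + 's) \<Rightarrow> _)"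
    by (rule vec.vector_space_axioms)
  show "module ((*s) :: 'a \<Rightarrow> 'a ^ ('r + 's) \<Rightarrow> _)"
    by (rule vec.module_axioms)
  show "vector_space (clifford_scale :: 'a \<Rightarrow> ('a, 'r, 's) clifford \<Rightarrow> _)"
    by (rule vector_space_clifford_scale)
  then show "module (clifford_scale :: 'a \<Rightarrow> ('a, 'r, 's) clifford \<Rightarrow> _)"
    by (simp add: module_iff_vector_space)
  show "clifford_vec (v + w) = clifford_vec v + clifford_vec w" for v w :: "'a ^ ('r + 's)"
    by transfer (simp add: tensor_vec_add clifford_rel_def clifford_ideal_closed(1))
  show "clifford_vec (a *s v) = clifford_scale a (clifford_vec v)" for a and v :: "'a ^ ('r + 's)"
    by transfer (simp add: tensor_vec_scaled clifford_rel_def clifford_ideal_closed(1))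
qed


section \<open>The maps \<open>c\<close> and \<open>\<beta>\<close>\<close>

definition clifford_automorphism ::
  "(('a::field, 'r::finite, 's::finite) clifford \<Rightarrow> ('a, 'r, 's) clifford) \<Rightarrow> bool" where
  "clifford_automorphism f \<longleftrightarrow> Vector_Spaces.linear clifford_scale clifford_scale f \<and> bij f \<and>
     f 1 = 1 \<and> (\<forall>x y. f (x * y) = f x * f y)"

definition clifford_anti_automorphism ::
  "(('a::field, 'r::finite, 's::finite) clifford \<Rightarrow> ('a, 'r, 's) clifford) \<Rightarrow> bool" where
  "clifford_anti_automorphism f \<longleftrightarrow> Vector_Spaces.linear clifford_scale clifford_scale f \<and> bij f \<and>
     f 1 = 1 \<and> (\<forall>x y. f (x * y) = f y * f x)"

definition conj_c :: "('a::field, 'r::finite, 's::finite) clifford \<Rightarrow> ('a, 'r, 's) clifford" where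
  "conj_c = (THE c. clifford_anti_automorphism c \<and> (\<forall>v. c (clifford_vec v) = - clifford_vec v))"

definition beta :: "('a::field, 'r::finite, 's::finite) clifford \<Rightarrow> ('a, 'r, 's) clifford" where
  "beta = (THE b. clifford_automorphism b \<and>
     (\<forall>i. b (clifford_vec (pos_basis i)) = clifford_vec (pos_basis i)) \<and>
     (\<forall>j. b (clifford_vec (neg_basis j)) = - clifford_vec (neg_basis j)))"

text \<open>
  Both descriptions are justified below, in \<open>conj_c_ex1\<close> and \<open>beta_ex1\<close>: the two maps are
  induced by the linear maps that send the word $w$ to $(-1)^{|w|}$ times its reversal, and to
  $(-1)^k w$, where $k$ is the number of letters of $w$ from the last $s$.
\<close>

definition tensor_ext ::
  "('i tensor_word \<Rightarrow> ('i, 'a::field) tensor_algebra) \<Rightarrow>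
     ('i, 'a) tensor_algebra \<Rightarrow> ('i, 'a) tensor_algebra" where
  "tensor_ext g p = (\<Sum>w\<in>Poly_Mapping.keys p. tensor_scalar (Poly_Mapping.lookup p w) * g w)"

lemma tensor_ext_superset:
  assumes "finite A" "Poly_Mapping.keys p \<subseteq> A"
  shows "tensor_ext g p = (\<Sum>w\<in>A. tensor_scalar (Poly_Mapping.lookup p w) * g w)"
  unfolding tensor_ext_def using assms
  by (intro sum.mono_neutral_left) (auto simp: in_keys_iff tensor_scalar_simps)

lemma tensor_ext_add: "tensor_ext g (p + q) = tensor_ext g p + tensor_ext g q"
proof -
  let ?A = "Poly_Mapping.keys p \<union> Poly_Mapping.keys q"
  have "Poly_Mapping.keys (p + q) \<subseteq> ?A" by (rule keys_add)
  then show ?thesis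
    by (simp add: tensor_ext_superset[of ?A] lookup_add tensor_scalar_simps distrib_right sum.distrib)
qed

lemma tensor_ext_zero: "tensor_ext g 0 = 0"
  by (simp add: tensor_ext_def)

lemma tensor_ext_single: "tensor_ext g (Poly_Mapping.single w a) = tensor_scalar a * g w"
  by (subst tensor_ext_superset[of "{w}"]) auto

lemma tensor_ext_uminus: "tensor_ext g (- p) = - tensor_ext g p"
  using tensor_ext_add[of g p "- p"] by (simp add: tensor_ext_zero add_eq_0_iff)

lemma tensor_ext_diff: "tensor_ext g (p - q) = tensor_ext g p - tensor_ext g q"
  by (simp only: diff_conv_add_uminus tensor_ext_add tensor_ext_uminus)

lemma tensor_ext_sum: "tensor_ext g (sum f A) = (\<Sum>x\<in>A. tensor_ext g (f x))"
  by (induction A rule: infinite_finite_induct) (simp_all add: tensor_ext_zero tensor_ext_add)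

lemma tensor_ext_scaled: "tensor_ext g (tensor_scalar a * p) = tensor_scalar a * tensor_ext g p"
proof (induction p rule: tensor_induct)
  case (single w b)
  have "tensor_scalar a * Poly_Mapping.single w b = Poly_Mapping.single w (a * b)"
    by (simp add: tensor_scalar_def mult_single)
  then show ?case by (simp add: tensor_ext_single tensor_scalar_simps mult.assoc)
qed (simp_all add: tensor_ext_zero tensor_ext_add distrib_left)

lemma tensor_ext_hom:
  assumes g: "\<And>u w. g (u + w) = g u * g w"
  shows "tensor_ext g (p * q) = tensor_ext g p * tensor_ext g q"
proof (induction p rule: tensor_induct)
  case (single u a)
  show ?case
  proof (induction q rule: tensor_induct)
    case (single w b)
    show ?case by (simp add: mult_single tensor_ext_single g tensor_scalar_swap)
  qed (simp_all add: tensor_ext_zero tensor_ext_add distrib_left)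
qed (simp_all add: tensor_ext_zero tensor_ext_add distrib_right)

lemma tensor_ext_anti_hom:
  assumes g: "\<And>u w. g (u + w) = g w * g u"
  shows "tensor_ext g (p * q) = tensor_ext g q * tensor_ext g p"
proof (induction p rule: tensor_induct)
  case (single u a)
  show ?case
  proof (induction q rule: tensor_induct)
    case (single w b)
    show ?case by (simp add: mult_single tensor_ext_single g tensor_scalar_swap mult.commute[of b a])
  qed (simp_all add: tensor_ext_zero tensor_ext_add distrib_left distrib_right)
qed (simp_all add: tensor_ext_zero tensor_ext_add distrib_left distrib_right)

lemma clifford_ideal_image:
  fixes x :: "('r::finite + 's::finite, 'a::field) tensor_algebra"
    and f :: "('r + 's, 'a) tensor_algebra \<Rightarrow> ('r + 's, 'a) tensor_algebra"
  assumes add: "\<And>p q. f (p + q) = f p + f q"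
    and mult: "(\<forall>p q. f (p * q) = f p * f q) \<or> (\<forall>p q. f (p * q) = f q * f p)"
    and gen: "\<And>v. f (tensor_vec v * tensor_vec v + tensor_scalar (Q_form v v)) \<in> clifford_ideal"
    and x: "x \<in> clifford_ideal"
  shows "f x \<in> clifford_ideal"
proof -
  have f0: "f 0 = 0" using add[of 0 0] by simp
  have fm: "f (- p) = - f p" for p
    using add[of p "- p"] f0 by (simp add: add_eq_0_iff)
  have "two_sided_ideal {x. f x \<in> clifford_ideal}"
    using mult by (auto simp: two_sided_ideal_def add f0 fm clifford_ideal_closed)
  then have "clifford_ideal \<subseteq> {x. f x \<in> clifford_ideal}"
    using gen by (subst clifford_ideal_def, intro hull_minimal) auto
  then show ?thesis using x by blast
qed

definition rev_word :: "'i tensor_word \<Rightarrow> ('i, 'a::field) tensor_algebra" where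
  "rev_word w = Poly_Mapping.single (Word (rev (letters w))) ((- 1) ^ length (letters w))"

definition beta_word :: "('r + 's) tensor_word \<Rightarrow> ('r + 's, 'a::field) tensor_algebra" where
  "beta_word w = Poly_Mapping.single w ((- 1) ^ length (filter (Not \<circ> isl) (letters w)))"

lemma rev_word_plus: "rev_word (u + w) = rev_word w * rev_word u"
  by (simp add: rev_word_def plus_tensor_word_def mult_single power_add mult.commute)

lemma beta_word_plus: "beta_word (u + w) = beta_word u * beta_word w"
  by (simp add: beta_word_def plus_tensor_word_def mult_single power_add)

lemma tensor_rev_vec: "tensor_ext rev_word (tensor_vec v) = - tensor_vec v"
  by (simp add: tensor_vec_def tensor_ext_sum tensor_ext_single rev_word_def tensor_scalar_def
      mult_single single_uminus sum_negf)

definition neg_reflect :: "'a::field ^ ('r::finite + 's::finite) \<Rightarrow> 'a ^ ('r + 's)" where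
  "neg_reflect v = (\<chi> k. case k of Inl i \<Rightarrow> v $ k | Inr j \<Rightarrow> - (v $ k))"

lemma tensor_beta_vec: "tensor_ext beta_word (tensor_vec v) = tensor_vec (neg_reflect v)"
  unfolding tensor_vec_def tensor_ext_sum
  by (rule sum.cong)
    (auto simp: tensor_ext_single beta_word_def tensor_scalar_def mult_single neg_reflect_def
      split: sum.split)

lemma Q_form_neg_reflect: "Q_form (neg_reflect v) (neg_reflect v) = Q_form v v"
  by (simp add: Q_form_def neg_reflect_def)

lemma tensor_ext_scalar:
  "tensor_ext rev_word (tensor_scalar a) = tensor_scalar a"
  "tensor_ext beta_word (tensor_scalar a) = tensor_scalar a"
  by (simp_all add: tensor_scalar_def tensor_ext_single rev_word_def beta_word_def
      zero_tensor_word_def mult_single plus_tensor_word_def)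

lemma clifford_rel_rev:
  fixes x y :: "('a::finite + 'b::finite, 'c::field) tensor_algebra"
  assumes "clifford_rel x y"
  shows "clifford_rel (tensor_ext rev_word x) (tensor_ext rev_word y)"
proof -
  have "tensor_ext rev_word (x - y) \<in> clifford_ideal"
  proof (rule clifford_ideal_image[where f = "tensor_ext rev_word"])
    show "(\<forall>p q :: ('a + 'b, 'c) tensor_algebra.
          tensor_ext rev_word (p * q) = tensor_ext rev_word p * tensor_ext rev_word q) \<or>
        (\<forall>p q :: ('a + 'b, 'c) tensor_algebra.
          tensor_ext rev_word (p * q) = tensor_ext rev_word q * tensor_ext rev_word p)"
      by (intro disjI2 allI tensor_ext_anti_hom rev_word_plus)
    show "x - y \<in> clifford_ideal"
      using assms by (simp add: clifford_rel_def)
    show "tensor_ext rev_word (tensor_vec v * tensor_vec v + tensor_scalar (Q_form v v))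
        \<in> clifford_ideal" for v :: "'c ^ ('a + 'b)"
      using clifford_ideal_gen[of v]
      by (simp add: tensor_ext_add tensor_ext_anti_hom[OF rev_word_plus] tensor_rev_vec
          tensor_ext_scalar)
  qed (rule tensor_ext_add)
  then show ?thesis
    by (simp add: clifford_rel_def tensor_ext_diff)
qed

lemma clifford_rel_beta:
  fixes x y :: "('a::finite + 'b::finite, 'c::field) tensor_algebra"
  assumes "clifford_rel x y"
  shows "clifford_rel (tensor_ext beta_word x) (tensor_ext beta_word y)"
proof -
  have "tensor_ext beta_word (x - y) \<in> clifford_ideal"
  proof (rule clifford_ideal_image[where f = "tensor_ext beta_word"])
    show "(\<forall>p q :: ('a + 'b, 'c) tensor_algebra.
          tensor_ext beta_word (p * q) = tensor_ext beta_word p * tensor_ext beta_word q) \<or>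
        (\<forall>p q :: ('a + 'b, 'c) tensor_algebra.
          tensor_ext beta_word (p * q) = tensor_ext beta_word q * tensor_ext beta_word p)"
      by (intro disjI1 allI tensor_ext_hom beta_word_plus)
    show "x - y \<in> clifford_ideal"
      using assms by (simp add: clifford_rel_def)
    show "tensor_ext beta_word (tensor_vec v * tensor_vec v + tensor_scalar (Q_form v v))
        \<in> clifford_ideal" for v :: "'c ^ ('a + 'b)"
      using clifford_ideal_gen[of "neg_reflect v"]
      by (simp add: tensor_ext_add tensor_ext_hom[OF beta_word_plus] tensor_beta_vec
          tensor_ext_scalar Q_form_neg_reflect)
  qed (rule tensor_ext_add)
  then show ?thesis
    by (simp add: clifford_rel_def tensor_ext_diff)
qed

lemma clifford_rel_refl: "clifford_rel x x"
  by (simp add: clifford_rel_def clifford_ideal_closed)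

lift_definition lifted_rev ::
  "('a::field, 'r::finite, 's::finite) clifford \<Rightarrow> ('a, 'r, 's) clifford" is "tensor_ext rev_word"
  by (rule clifford_rel_rev)

lift_definition lifted_beta ::
  "('a::field, 'r::finite, 's::finite) clifford \<Rightarrow> ('a, 'r, 's) clifford" is "tensor_ext beta_word"
  by (rule clifford_rel_beta)

lemma tensor_rev_rev: "tensor_ext rev_word (tensor_ext rev_word p) = p"
  by (induction p rule: tensor_induct)
    (simp_all add: tensor_ext_zero tensor_ext_add tensor_ext_single tensor_ext_scaled rev_word_def
      tensor_scalar_def mult_single mult.assoc)

lemma tensor_beta_beta: "tensor_ext beta_word (tensor_ext beta_word p) = p"
  by (induction p rule: tensor_induct)
    (simp_all add: tensor_ext_zero tensor_ext_add tensor_ext_single tensor_ext_scaled beta_word_def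
      tensor_scalar_def mult_single mult.assoc)

lemma clifford_linearI:
  fixes f :: "('a::field, 'r::finite, 's::finite) clifford \<Rightarrow> ('a, 'r, 's) clifford"
  assumes "\<And>x y. f (x + y) = f x + f y" "\<And>a x. f (clifford_scale a x) = clifford_scale a (f x)"
  shows "Vector_Spaces.linear clifford_scale clifford_scale f"
  unfolding module_hom_iff_linear[symmetric]
  using assms vector_space_clifford_scale
  by (intro module_hom.intro module_hom_axioms.intro) (simp_all add: module_iff_vector_space)

lemma clifford_anti_automorphism_rev:
  "clifford_anti_automorphism lifted_rev" (is ?A)
  "lifted_rev (clifford_vec v) = - clifford_vec v" (is ?B)
proof -
  have "lifted_rev (lifted_rev x) = x" for x :: "('a, 'b, 'c) clifford"
    by transfer (simp add: tensor_rev_rev clifford_rel_refl)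
  then have "bij (lifted_rev :: ('a, 'b, 'c) clifford \<Rightarrow> _)"
    by (intro o_bij[where g = lifted_rev]) auto
  moreover have "lifted_rev (x + y) = lifted_rev x + lifted_rev y"
    for x y :: "('a, 'b, 'c) clifford"
    by transfer (simp add: tensor_ext_add clifford_rel_refl)
  moreover have "lifted_rev (clifford_scale a x) = clifford_scale a (lifted_rev x)"
    for a and x :: "('a, 'b, 'c) clifford"
    by transfer (simp add: tensor_ext_scaled clifford_rel_refl)
  moreover have "lifted_rev 1 = (1 :: ('a, 'b, 'c) clifford)"
    by transfer (metis tensor_ext_scalar(1) tensor_scalar_simps(3) clifford_rel_refl)
  moreover have "lifted_rev (x * y) = lifted_rev y * lifted_rev x"
    for x y :: "('a, 'b, 'c) clifford"
    by transfer (simp add: tensor_ext_anti_hom[OF rev_word_plus] clifford_rel_refl)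
  ultimately show ?A
    unfolding clifford_anti_automorphism_def by (auto intro: clifford_linearI)
  show ?B
    by transfer (simp add: tensor_rev_vec clifford_rel_refl)
qed

lemma neg_reflect_basis:
  "neg_reflect (pos_basis i) = pos_basis i"
  "neg_reflect (neg_basis j) = - neg_basis j"
  by (auto simp: neg_reflect_def pos_basis_def neg_basis_def axis_def vec_eq_iff split: sum.split)

lemma tensor_vec_uminus: "tensor_vec (- v) = - tensor_vec v"
  by (simp add: tensor_vec_def single_uminus sum_negf)

lemma clifford_automorphism_beta:
  "clifford_automorphism lifted_beta" (is ?A)
  "lifted_beta (clifford_vec (pos_basis i)) = clifford_vec (pos_basis i)" (is ?B)
  "lifted_beta (clifford_vec (neg_basis j)) = - clifford_vec (neg_basis j)" (is ?C)
proof -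
  have "lifted_beta (lifted_beta x) = x" for x :: "('a, 'b, 'c) clifford"
    by transfer (simp add: tensor_beta_beta clifford_rel_refl)
  then have "bij (lifted_beta :: ('a, 'b, 'c) clifford \<Rightarrow> _)"
    by (intro o_bij[where g = lifted_beta]) auto
  moreover have "lifted_beta (x + y) = lifted_beta x + lifted_beta y"
    for x y :: "('a, 'b, 'c) clifford"
    by transfer (simp add: tensor_ext_add clifford_rel_refl)
  moreover have "lifted_beta (clifford_scale a x) = clifford_scale a (lifted_beta x)"
    for a and x :: "('a, 'b, 'c) clifford"
    by transfer (simp add: tensor_ext_scaled clifford_rel_refl)
  moreover have "lifted_beta 1 = (1 :: ('a, 'b, 'c) clifford)"
    by transfer (metis tensor_ext_scalar(2) tensor_scalar_simps(3) clifford_rel_refl)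
  moreover have "lifted_beta (x * y) = lifted_beta x * lifted_beta y"
    for x y :: "('a, 'b, 'c) clifford"
    by transfer (simp add: tensor_ext_hom[OF beta_word_plus] clifford_rel_refl)
  ultimately show ?A
    unfolding clifford_automorphism_def by (auto intro: clifford_linearI)
  show ?B
    by transfer (simp add: tensor_beta_vec neg_reflect_basis clifford_rel_refl)
  show ?C
    by transfer (simp add: tensor_beta_vec neg_reflect_basis tensor_vec_uminus clifford_rel_refl)
qed

lemma clifford_induct [case_names one add scale vec]:
  fixes x :: "('a::field, 'r::finite, 's::finite) clifford"
  assumes one: "P 1" and add: "\<And>x y. P x \<Longrightarrow> P y \<Longrightarrow> P (x + y)"
    and scale: "\<And>a x. P x \<Longrightarrow> P (clifford_scale a x)"
    and vec: "\<And>k x. P x \<Longrightarrow> P (clifford_vec (axis k 1) * x)"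
  shows "P x"
proof -
  have word: "P (abs_clifford (Poly_Mapping.single (Word ks) (1::'a)))" for ks
  proof (induction ks)
    case Nil
    then show ?case
      using one by (simp add: one_clifford_def flip: zero_tensor_word_def)
  next
    case (Cons k ks)
    have "abs_clifford (Poly_Mapping.single (Word (k # ks)) (1::'a))
        = clifford_vec (axis k 1) * abs_clifford (Poly_Mapping.single (Word ks) 1)"
      by (simp add: clifford_vec.abs_eq times_clifford.abs_eq tensor_vec_axis mult_single
          plus_tensor_word_def)
    then show ?case using vec Cons by simp
  qed
  have "P (abs_clifford p)" for p
  proof (induction p rule: tensor_induct)
    case zero
    have "abs_clifford 0 = (clifford_scale 0 1 :: ('a, 'r, 's) clifford)"
      by (simp add: one_clifford_def clifford_scale.abs_eq tensor_scalar_simps)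
    then show ?case using one scale by simp
  next
    case (single w a)
    obtain ks where w: "w = Word ks" by (cases w)
    have "abs_clifford (Poly_Mapping.single w a)
        = clifford_scale a (abs_clifford (Poly_Mapping.single (Word ks) (1::'a)))"
      by (simp add: w clifford_scale.abs_eq tensor_scalar_def mult_single)
    then show ?case using scale[OF word] by simp
  next
    case (add p q)
    then show ?case using assms(2) by (simp flip: plus_clifford.abs_eq)
  qed
  then show ?thesis by (rule clifford.abs_induct)
qed

lemma clifford_linearD:
  assumes "Vector_Spaces.linear clifford_scale clifford_scale f"
  shows "f (x + y) = f x + f y" "f (clifford_scale a x) = clifford_scale a (f x)"
  using assms unfolding module_hom_iff_linear[symmetric]
  by (simp_all add: module_hom.add module_hom.scale)

lemma clifford_anti_automorphism_unique:
  assumes "clifford_anti_automorphism f" "clifford_anti_automorphism g"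
    and "\<And>k. f (clifford_vec (axis k 1)) = g (clifford_vec (axis k 1))"
  shows "f = g"
proof
  show "f x = g x" for x
    using assms
    by (induction x rule: clifford_induct)
      (simp_all add: clifford_anti_automorphism_def clifford_linearD)
qed

lemma clifford_automorphism_unique:
  assumes "clifford_automorphism f" "clifford_automorphism g"
    and "\<And>k. f (clifford_vec (axis k 1)) = g (clifford_vec (axis k 1))"
  shows "f = g"
proof
  show "f x = g x" for x
    using assms
    by (induction x rule: clifford_induct)
      (simp_all add: clifford_automorphism_def clifford_linearD)
qed

lemma conj_c_ex1:
  "\<exists>!c :: ('a::field, 'r::finite, 's::finite) clifford \<Rightarrow> _.
     clifford_anti_automorphism c \<and> (\<forall>v. c (clifford_vec v) = - clifford_vec v)"
  by (rule ex1I[of _ lifted_rev])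
    (auto simp: clifford_anti_automorphism_rev intro!: clifford_anti_automorphism_unique)

lemma conj_c:
  "clifford_anti_automorphism conj_c" "conj_c (clifford_vec v) = - clifford_vec v"
  using theI'[OF conj_c_ex1] unfolding conj_c_def[symmetric] by auto

lemma beta_ex1:
  "\<exists>!b :: ('a::field, 'r::finite, 's::finite) clifford \<Rightarrow> _.
     clifford_automorphism b \<and>
     (\<forall>i. b (clifford_vec (pos_basis i)) = clifford_vec (pos_basis i)) \<and>
     (\<forall>j. b (clifford_vec (neg_basis j)) = - clifford_vec (neg_basis j))"
proof (rule ex1I[of _ lifted_beta])
  fix b :: "('a, 'r, 's) clifford \<Rightarrow> ('a, 'r, 's) clifford"
  assume b: "clifford_automorphism b \<and>
     (\<forall>i. b (clifford_vec (pos_basis i)) = clifford_vec (pos_basis i)) \<and>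
     (\<forall>j. b (clifford_vec (neg_basis j)) = - clifford_vec (neg_basis j))"
  show "b = lifted_beta"
  proof (rule clifford_automorphism_unique)
    show "b (clifford_vec (axis k 1)) = lifted_beta (clifford_vec (axis k 1))" for k
    proof (cases k)
      case (Inl i)
      then show ?thesis
        using b by (simp add: pos_basis_def clifford_automorphism_beta(2)[unfolded pos_basis_def])
    next
      case (Inr j)
      then show ?thesis
        using b by (simp add: neg_basis_def clifford_automorphism_beta(3)[unfolded neg_basis_def])
    qed
  qed (use b clifford_automorphism_beta(1) in auto)
qed (auto simp: clifford_automorphism_beta)

lemma beta:
  "clifford_automorphism beta"
  "beta (clifford_vec (pos_basis i)) = clifford_vec (pos_basis i)"
  "beta (clifford_vec (neg_basis j)) = - clifford_vec (neg_basis j)"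
  using theI'[OF beta_ex1] unfolding beta_def[symmetric] by auto


section \<open>The spaces \<open>G\<close> and \<open>P\<close>\<close>

definition G_space :: "('a::field, 'r::finite, 's::finite) clifford set" where
  "G_space = {\<phi>. conj_c \<phi> = - \<phi>}"

definition P_space :: "('a::field, 'r::finite, 's::finite) clifford set" where
  "P_space = {\<phi> \<in> G_space. beta \<phi> = - \<phi>}"

end

theory Submission
  imports Defs
begin

text \<open>
  Write $e_I$ for the product of the $e_k$ with $k \in I$ in a fixed order.  The $e_I$ span the
  Clifford algebra because left multiplication by $e_k$ sends $e_I$ to a multiple of
  $e_{I \triangle \{k\}}$.  They are independent because the algebra acts on the functions on
  subsets, and $e_I$ moves the point mass at $\emptyset$ to a nonzero multiple of the point mass at
  $I$.  Both maps are diagonal in this basis: $c(e_I) = (-1)^{|I|(|I|+1)/2} e_I$ and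
  $\beta(e_I) = (-1)^b e_I$, where $b$ is the number of elements of $I$ among the last $s$ indices.
  So the dimension is the number of $I$ with $|I| \equiv 1, 2$ modulo 4 and $b$ odd.  As
  $(-1)^{k(k+1)/2} = \mathrm{Re}((1+i) i^k)$, the binomial theorem evaluates this number to
  $\frac14 (2^n + \mathrm{Re}((1+i)^{r+1} ((1-i)^s - (1+i)^s)))$, which is the formula of part 1
  for all $r, s \ge 1$; the other parts are specialisations.
\<close>

section \<open>A faithful representation\<close>

definition toggle :: "'i \<Rightarrow> 'i set \<Rightarrow> 'i set" where
  "toggle k K = (if k \<in> K then K - {k} else insert k K)"

lemma mem_toggle: "j \<in> toggle k K \<longleftrightarrow> (if j = k then k \<notin> K else j \<in> K)"
  by (auto simp: toggle_def)

lemma toggle_toggle: "toggle k (toggle k K) = K"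
  by (auto simp: mem_toggle set_eq_iff)

lemma toggle_commute: "toggle i (toggle j K) = toggle j (toggle i K)"
  by (auto simp: mem_toggle set_eq_iff)

text \<open>An arbitrary injective numbering; it orders the letters so that the signs of reordering
  can be counted.\<close>

definition letter_rank :: "'i::finite \<Rightarrow> nat" where
  "letter_rank = to_nat_on UNIV"

lemma letter_rank_eq_iff: "letter_rank i = letter_rank j \<longleftrightarrow> i = j"
  using inj_on_to_nat_on[of "UNIV :: 'a set"]
  by (auto simp: letter_rank_def inj_on_def)

text \<open>The value of Q on the basis vector with index \<open>k\<close>, so e_k squares to
  \<open>- letter_norm k\<close>.\<close>

definition letter_norm :: "'r + 's \<Rightarrow> 'a::field" where
  "letter_norm k = (if isl k then 1 else - 1)"

text \<open>
  \<open>letter_act k\<close> is left multiplication by $e_k$ in coordinates: \<open>f K\<close> is the coefficient of $e_K$,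
  the sign counts the letters that $e_k$ has to pass, and the factor $e_k^2$ appears when \<open>k\<close> is not
  in \<open>K\<close>, because the coefficient then comes from $e_{K \cup \{k\}}$.
\<close>

definition act_sign :: "'r::finite + 's::finite \<Rightarrow> ('r + 's) set \<Rightarrow> 'a::field" where
  "act_sign k K = (- 1) ^ card {j \<in> K. letter_rank j < letter_rank k} *
     (if k \<in> K then 1 else - letter_norm k)"

definition letter_act ::
  "'r::finite + 's::finite \<Rightarrow> (('r + 's) set \<Rightarrow> 'a::field) \<Rightarrow> ('r + 's) set \<Rightarrow> 'a" where
  "letter_act k f K = act_sign k K * f (toggle k K)"

text \<open>Toggling \<open>i\<close> changes the counted number by exactly one if
  \<open>P i\<close> holds and not at all otherwise.\<close>

lemma minus_one_power_card_toggle: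
  fixes P :: "'i::finite \<Rightarrow> bool"
  shows "(- 1 :: 'a::field) ^ card {j \<in> toggle i K. P j}
    = (if P i then - 1 else 1) * (- 1) ^ card {j \<in> K. P j}"
proof -
  have "{j \<in> toggle i K. P j} = (if P i then toggle i {j \<in> K. P j} else {j \<in> K. P j})"
    by (auto simp: mem_toggle)
  moreover have "(- 1 :: 'a) ^ card (toggle i M) = - ((- 1) ^ card M)" for M
  proof (cases "i \<in> M")
    case True
    then show ?thesis by (simp add: toggle_def card.remove[of M i] del: card_Diff_insert)
  qed (simp add: toggle_def)
  ultimately show ?thesis by simp
qed

text \<open>No letter precedes itself, so both counting signs agree and cancel. Exactly one of the
  two sets lacks \<open>k\<close>, and it contributes the factor
  \<open>- letter_norm k\<close>.\<close>

lemma act_sign_toggle_self: "act_sign k K * act_sign k (toggle k K) = - letter_norm k"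
proof -
  have "(- 1 :: 'a) ^ n * (- 1) ^ n = 1" for n by (simp flip: power_mult_distrib)
  then show ?thesis
    unfolding act_sign_def minus_one_power_card_toggle
    by (simp add: mem_toggle algebra_simps flip: mult.assoc)
qed

lemma act_sign_toggle_other:
  "i \<noteq> j \<Longrightarrow> act_sign j (toggle i K)
    = (if letter_rank i < letter_rank j then - 1 else 1) * act_sign j K"
  unfolding act_sign_def minus_one_power_card_toggle by (simp add: mem_toggle)

lemma letter_act_square: "letter_act k (letter_act k f) K = - letter_norm k * f K"
  by (simp add: letter_act_def toggle_toggle act_sign_toggle_self flip: mult.assoc)

text \<open>Both composites evaluate \<open>f\<close> at the same set. Exactly one of
  \<open>i\<close>, \<open>j\<close> precedes the other, so exactly one of the two composites picks
  up an extra minus sign.\<close>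

lemma letter_act_anticommute:
  assumes "i \<noteq> j"
  shows "letter_act i (letter_act j f) K + letter_act j (letter_act i f) K = 0"
proof (cases "letter_rank i < letter_rank j")
  case True
  then show ?thesis
    using assms by (simp add: letter_act_def act_sign_toggle_other toggle_commute[of i j])
next
  case False
  then have "letter_rank j < letter_rank i"
    using assms letter_rank_eq_iff[of i j] by linarith
  then show ?thesis
    using assms by (simp add: letter_act_def act_sign_toggle_other toggle_commute[of i j])
qed

section \<open>Extension of the action to the tensor algebra and descent to the quotient\<close>

definition word_act ::
  "('r::finite + 's::finite) tensor_word \<Rightarrow> (('r + 's) set \<Rightarrow> 'a::field) \<Rightarrow> ('r + 's) set \<Rightarrow> 'a" where
  "word_act w = foldr letter_act (letters w)"

lemma word_act_plus: "word_act (u + w) f = word_act u (word_act w f)"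
  by (simp add: word_act_def plus_tensor_word_def)

lemma word_act_linear:
  "word_act w (\<lambda>K. f K + g K) = (\<lambda>K. word_act w f K + word_act w g K)"
  "word_act w (\<lambda>K. a * f K) = (\<lambda>K. a * word_act w f K)"
proof -
  have "foldr letter_act ks (\<lambda>K. f K + g K) = (\<lambda>K. foldr letter_act ks f K + foldr letter_act ks g K)"
    for ks by (induction ks) (simp_all add: letter_act_def fun_eq_iff algebra_simps)
  then show "word_act w (\<lambda>K. f K + g K) = (\<lambda>K. word_act w f K + word_act w g K)"
    by (simp add: word_act_def)
  have "foldr letter_act ks (\<lambda>K. a * f K) = (\<lambda>K. a * foldr letter_act ks f K)"
    for ks by (induction ks) (simp_all add: letter_act_def fun_eq_iff algebra_simps)
  then show "word_act w (\<lambda>K. a * f K) = (\<lambda>K. a * word_act w f K)"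
    by (simp add: word_act_def)
qed

lemma word_act_zero: "word_act w (\<lambda>K. 0) = (\<lambda>K. 0)"
  using word_act_linear(2)[of w 0 "\<lambda>K. 0"] by simp

definition tensor_act ::
  "('r::finite + 's::finite, 'a::field) tensor_algebra \<Rightarrow>
     (('r + 's) set \<Rightarrow> 'a) \<Rightarrow> ('r + 's) set \<Rightarrow> 'a" where
  "tensor_act p f K = (\<Sum>w\<in>Poly_Mapping.keys p. Poly_Mapping.lookup p w * word_act w f K)"

lemma tensor_act_superset:
  assumes "finite A" "Poly_Mapping.keys p \<subseteq> A"
  shows "tensor_act p f K = (\<Sum>w\<in>A. Poly_Mapping.lookup p w * word_act w f K)"
  unfolding tensor_act_def using assms
  by (intro sum.mono_neutral_left) (auto simp: in_keys_iff)

lemma tensor_act_zero: "tensor_act 0 f = (\<lambda>K. 0)"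
  by (simp add: tensor_act_def fun_eq_iff)

lemma tensor_act_add: "tensor_act (p + q) f = (\<lambda>K. tensor_act p f K + tensor_act q f K)"
proof
  fix K
  let ?A = "Poly_Mapping.keys p \<union> Poly_Mapping.keys q"
  have "Poly_Mapping.keys (p + q) \<subseteq> ?A" by (rule keys_add)
  then show "tensor_act (p + q) f K = tensor_act p f K + tensor_act q f K"
    by (simp add: tensor_act_superset[of ?A] lookup_add distrib_right sum.distrib)
qed

lemma tensor_act_uminus: "tensor_act (- p) f = (\<lambda>K. - tensor_act p f K)"
  using tensor_act_add[of p "- p" f] by (simp add: tensor_act_zero fun_eq_iff add_eq_0_iff)

lemma tensor_act_sum: "tensor_act (sum p A) f = (\<lambda>K. \<Sum>i\<in>A. tensor_act (p i) f K)"
  by (induction A rule: infinite_finite_induct) (simp_all add: tensor_act_zero tensor_act_add)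

lemma tensor_act_single:
  "tensor_act (Poly_Mapping.single w a) f = (\<lambda>K. a * word_act w f K)"
  by (rule ext, subst tensor_act_superset[of "{w}"]) auto

lemma tensor_act_zero_arg: "tensor_act p (\<lambda>K. 0) = (\<lambda>K. 0)"
  by (simp add: tensor_act_def word_act_zero fun_eq_iff)

lemma tensor_act_mult: "tensor_act (p * q) f = tensor_act p (tensor_act q f)"
proof (induction p rule: tensor_induct)
  case (single u a)
  show ?case
  proof (induction q rule: tensor_induct)
    case zero
    show ?case by (simp add: tensor_act_zero tensor_act_zero_arg)
  next
    case (single w b)
    show ?case by (simp add: mult_single tensor_act_single word_act_plus word_act_linear mult.assoc)
  next
    case (add p q)
    then show ?case
      by (simp add: distrib_left tensor_act_add) (simp add: tensor_act_single word_act_linear distrib_left)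
  qed
qed (simp_all add: tensor_act_zero tensor_act_add distrib_right)

lemma tensor_act_scalar: "tensor_act (tensor_scalar a) f = (\<lambda>K. a * f K)"
  by (simp add: tensor_scalar_def tensor_act_single word_act_def zero_tensor_word_def)

lemma tensor_act_vec: "tensor_act (tensor_vec v) f = (\<lambda>K. \<Sum>k\<in>UNIV. v $ k * letter_act k f K)"
  by (simp add: tensor_vec_def tensor_act_sum tensor_act_single word_act_def)

lemma Q_form_eq_sum: "Q_form v v = (\<Sum>k\<in>UNIV. letter_norm k * (v $ k * v $ k))"
proof -
  have "(\<Sum>k\<in>UNIV <+> UNIV. letter_norm k * (v $ k * v $ k)) = Q_form v v"
    by (subst sum.Plus) (simp_all add: letter_norm_def Q_form_def sum_negf)
  then show ?thesis by simp
qed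

text \<open>The off-diagonal terms cancel in pairs (i, j), (j, i): in the induction the new row
  cancels the new column. No division by 2 occurs, so this works in every characteristic.\<close>

lemma double_sum_antisymmetric:
  fixes a :: "'i \<Rightarrow> 'i \<Rightarrow> 'b::ab_group_add"
  assumes "finite A" and "\<And>i j. i \<noteq> j \<Longrightarrow> a i j + a j i = 0"
  shows "(\<Sum>i\<in>A. \<Sum>j\<in>A. a i j) = (\<Sum>i\<in>A. a i i)"
  using \<open>finite A\<close>
proof (induction A rule: finite_induct)
  case (insert x A)
  have "(\<Sum>j\<in>A. a x j) + (\<Sum>i\<in>A. a i x) = (\<Sum>j\<in>A. 0)"
    unfolding sum.distrib[symmetric] using insert.hyps assms(2) by (intro sum.cong) metis+
  then show ?case
    using insert by (simp add: sum.distrib algebra_simps)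
qed simp

text \<open>Expanding v in the basis, the mixed terms cancel by anticommutation and the squares add
  up to -Q(v,v).\<close>

lemma tensor_act_generator:
  "tensor_act (tensor_vec v * tensor_vec v + tensor_scalar (Q_form v v)) f = (\<lambda>K. 0)"
proof
  fix K
  have "tensor_act (tensor_vec v * tensor_vec v) f K
      = (\<Sum>i\<in>UNIV. \<Sum>j\<in>UNIV. v $ i * v $ j * letter_act i (letter_act j f) K)"
    by (simp add: tensor_act_mult tensor_act_vec letter_act_def sum_distrib_left mult_ac)
  also have "\<dots> = (\<Sum>i\<in>UNIV. v $ i * v $ i * letter_act i (letter_act i f) K)"
  proof (rule double_sum_antisymmetric)
    fix i j :: "'a + 'b" assume "i \<noteq> j"
    then have "v $ i * v $ j * (letter_act i (letter_act j f) K + letter_act j (letter_act i f) K) = 0"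
      using letter_act_anticommute[of i j f K] by simp
    then show "v $ i * v $ j * letter_act i (letter_act j f) K
        + v $ j * v $ i * letter_act j (letter_act i f) K = 0"
      by (simp add: algebra_simps)
  qed simp
  also have "\<dots> = - Q_form v v * f K"
    by (simp add: letter_act_square Q_form_eq_sum sum_distrib_left sum_negf mult_ac)
  finally show "tensor_act (tensor_vec v * tensor_vec v + tensor_scalar (Q_form v v)) f K = 0"
    by (simp add: tensor_act_add tensor_act_scalar)
qed

text \<open>The annihilator of the representation is a two-sided ideal containing the generators,
  hence contains their hull.\<close>

lemma tensor_act_clifford_ideal:
  assumes "p \<in> clifford_ideal"
  shows "tensor_act p f = (\<lambda>K. 0)"
proof -
  \<comment> \<open>Quantifying over all \<open>f\<close> makes the set closed under right
    multiplication, since \<open>x * a\<close> acts on \<open>f\<close> as \<open>x\<close> acts on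
    the image of \<open>f\<close> under \<open>a\<close>.\<close>
  let ?I = "{p :: ('a + 'b, 'c) tensor_algebra. \<forall>f. tensor_act p f = (\<lambda>K. 0)}"
  have "two_sided_ideal ?I"
    by (auto simp: two_sided_ideal_def tensor_act_zero tensor_act_add tensor_act_uminus
        tensor_act_mult tensor_act_zero_arg)
  then have "clifford_ideal \<subseteq> ?I"
    unfolding clifford_ideal_def by (intro hull_minimal) (auto simp: tensor_act_generator)
  then show ?thesis using assms by blast
qed

lift_definition clifford_act ::
  "('a::field, 'r::finite, 's::finite) clifford \<Rightarrow> (('r + 's) set \<Rightarrow> 'a) \<Rightarrow> ('r + 's) set \<Rightarrow> 'a"
  is tensor_act
proof -
  fix x y :: "('r + 's, 'a) tensor_algebra"
  assume "clifford_rel x y"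
  then have "tensor_act (x - y) f = (\<lambda>K. 0)" for f
    unfolding clifford_rel_def by (rule tensor_act_clifford_ideal)
  moreover have "tensor_act (x - y) f = (\<lambda>K. tensor_act x f K - tensor_act y f K)" for f
    using tensor_act_add[of x "- y" f] by (simp add: tensor_act_uminus)
  ultimately show "tensor_act x = tensor_act y"
    by (simp add: fun_eq_iff)
qed

lemma clifford_act_simps:
  "clifford_act 1 f K = f K"
  "clifford_act (x + y) f K = clifford_act x f K + clifford_act y f K"
  "clifford_act (x * y) f = clifford_act x (clifford_act y f)"
  "clifford_act (clifford_scale a x) f K = a * clifford_act x f K"
  by (transfer, simp add: tensor_act_add tensor_act_mult tensor_act_scalar
      flip: tensor_scalar_simps(3))+

lemma clifford_act_vec: "clifford_act (clifford_vec (axis k 1)) f = letter_act k f"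
  by transfer (simp add: tensor_vec_axis tensor_act_single word_act_def)

section \<open>The basis of the Clifford algebra\<close>

interpretation clifford: vector_space clifford_scale
  by (rule vector_space_clifford_scale)

section \<open>Relations between the generators\<close>

definition clifford_gen :: "'r::finite + 's::finite \<Rightarrow> ('a::field, 'r, 's) clifford" where
  "clifford_gen k = clifford_vec (axis k 1)"

lemma Q_form_axis: "Q_form (axis k 1) (axis k 1) = letter_norm k"
  by (cases k) (simp_all add: Q_form_basis letter_norm_def flip: pos_basis_def neg_basis_def)

lemma Q_form_axis_neq: "i \<noteq> j \<Longrightarrow> Q_form (axis i 1) (axis j 1) = 0"
  by (cases i; cases j) (simp_all add: Q_form_basis flip: pos_basis_def neg_basis_def)

lemma clifford_gen_square: "clifford_gen k * clifford_gen k = clifford_scale (- letter_norm k) 1"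
  by (simp add: clifford_gen_def clifford_vec_square Q_form_axis)

text \<open>Polarisation: by orthogonality the square of e_i + e_j is the sum of the two squares, so
  the mixed terms add up to 0.\<close>

lemma clifford_gen_anticommute:
  assumes "i \<noteq> j"
  shows "clifford_gen i * clifford_gen j
    = (- (clifford_gen j * clifford_gen i) :: ('a::field, 'r::finite, 's::finite) clifford)"
proof -
  let ?v = "axis i 1" and ?w = "axis j 1 :: 'a ^ ('r + 's)"
  have *: "clifford_vec (?v + ?w) = clifford_gen i + clifford_gen j"
    using module_hom.add[OF linear_clifford_vec[folded module_hom_iff_linear]]
    by (simp add: clifford_gen_def)
  have "Q_form (?v + ?w) (?v + ?w) = letter_norm i + letter_norm j"
    using assms Q_form_sym[of ?v "?v + ?w"] Q_form_sym[of ?w "?v + ?w"]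
    by (simp add: Q_form_add Q_form_axis Q_form_axis_neq)
  then have "(clifford_gen i + clifford_gen j) * (clifford_gen i + clifford_gen j)
      = (clifford_gen i * clifford_gen i + clifford_gen j * clifford_gen j :: ('a, 'r, 's) clifford)"
    using clifford_vec_square[of "?v + ?w"]
    by (simp add: * clifford_gen_square clifford.scale_left_diff_distrib)
  then show ?thesis by (simp add: algebra_simps eq_neg_iff_add_eq_0)
qed

section \<open>Products of distinct generators: spanning and independence\<close>

definition gen_word :: "('r::finite + 's::finite) list \<Rightarrow> ('a::field, 'r, 's) clifford" where
  "gen_word xs = prod_list (map clifford_gen xs)"

lemma gen_word_simps: "gen_word [] = 1" "gen_word (x # xs) = clifford_gen x * gen_word xs"
  by (simp_all add: gen_word_def)

text \<open>The factor e_k moves right, changing sign at each letter it passes, up to its own place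
  in \<open>xs\<close>. There it is either inserted or merges with the e_k already present into a
  scalar.\<close>

lemma gen_mult_word_filter:
  fixes k :: "'r::finite + 's::finite"
  assumes "distinct xs" "k \<in> set xs"
  shows "\<exists>a. clifford_gen k * gen_word (filter (\<lambda>j. j \<in> I) xs)
    = (clifford_scale a (gen_word (filter (\<lambda>j. j \<in> toggle k I) xs))
       :: ('a::field, 'r, 's) clifford)"
  using assms
proof (induction xs)
  case (Cons x xs)
  show ?case
  proof (cases "x = k")
    case True
    then have "filter (\<lambda>j. j \<in> toggle k I) xs = filter (\<lambda>j. j \<in> I) xs"
      using Cons.prems by (auto simp: mem_toggle intro!: filter_cong)
    moreover have "k \<in> toggle k I \<longleftrightarrow> k \<notin> I" by (simp add: mem_toggle)
    ultimately have "clifford_gen k * gen_word (filter (\<lambda>j. j \<in> I) (x # xs))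
        = clifford_scale (if k \<in> I then - letter_norm k else 1)
            (gen_word (filter (\<lambda>j. j \<in> toggle k I) (x # xs)))"
      using True by (simp add: gen_word_simps clifford_gen_square clifford_scale_mult
          flip: mult.assoc)
    then show ?thesis by blast
  next
    case False
    then obtain a where a: "clifford_gen k * gen_word (filter (\<lambda>j. j \<in> I) xs)
        = (clifford_scale a (gen_word (filter (\<lambda>j. j \<in> toggle k I) xs))
           :: ('a, 'r, 's) clifford)"
      using Cons by auto
    have "x \<in> toggle k I \<longleftrightarrow> x \<in> I"
      using False by (simp add: mem_toggle)
    show ?thesis
    proof (cases "x \<in> I")
      case True
      have "clifford_gen k * (clifford_gen x * gen_word (filter (\<lambda>j. j \<in> I) xs))
          = - (clifford_gen x * (clifford_gen k * gen_word (filter (\<lambda>j. j \<in> I) xs)))"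
        using False by (simp add: clifford_gen_anticommute[of k x] flip: mult.assoc)
      also have "\<dots> = clifford_scale (- a)
          (clifford_gen x * gen_word (filter (\<lambda>j. j \<in> toggle k I) xs))"
        by (simp add: a clifford_scale_mult)
      finally have "clifford_gen k * gen_word (filter (\<lambda>j. j \<in> I) (x # xs))
          = clifford_scale (- a) (gen_word (filter (\<lambda>j. j \<in> toggle k I) (x # xs)))"
        using True \<open>x \<in> toggle k I \<longleftrightarrow> x \<in> I\<close> by (simp add: gen_word_simps)
      then show ?thesis by blast
    qed (use a False in \<open>auto simp: mem_toggle\<close>)
  qed
qed simp

text \<open>This order may differ from that of \<open>letter_rank\<close>, which is why
  \<open>gen_word_act_point\<close> asserts only some nonzero scalar.\<close>

definition all_letters :: "'i::finite list" where
  "all_letters = (SOME xs. distinct xs \<and> set xs = UNIV)"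

lemma all_letters: "distinct (all_letters :: 'i::finite list)" "set (all_letters :: 'i list) = UNIV"
proof -
  have "\<exists>xs. distinct xs \<and> set xs = (UNIV :: 'i set)"
    using finite_distinct_list[OF finite] by blast
  from someI_ex[OF this]
  show "distinct (all_letters :: 'i list)" "set all_letters = (UNIV :: 'i set)"
    by (simp_all add: all_letters_def)
qed

definition basis_word :: "('r::finite + 's::finite) set \<Rightarrow> ('a::field, 'r, 's) clifford" where
  "basis_word I = gen_word (filter (\<lambda>j. j \<in> I) all_letters)"

text \<open>The span contains 1 and is closed under left multiplication by generators, so
  \<open>clifford_induct\<close> reaches every element.\<close>

lemma span_basis_word: "clifford.span (range basis_word) = UNIV"
proof -
  let ?S = "clifford.span (range basis_word) :: ('a, 'b, 'c) clifford set"
  have "x \<in> ?S" for x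
  proof (induction x rule: clifford_induct)
    case one
    have "1 = basis_word {}" by (simp add: basis_word_def gen_word_simps)
    then show ?case by (metis clifford.span_base rangeI)
  next
    case (vec k x)
    then show ?case
    proof (induction x rule: clifford.span_induct_alt)
      case base
      show ?case by (simp add: clifford.span_zero)
    next
      case (step c x y)
      then obtain I where I: "x = basis_word I" by auto
      obtain a where "clifford_gen k * basis_word I
          = (clifford_scale a (basis_word (toggle k I)) :: ('a, 'b, 'c) clifford)"
        using gen_mult_word_filter[of all_letters k I] all_letters unfolding basis_word_def by blast
      then show ?case
        using step(2) I
        by (simp add: distrib_left clifford_scale_mult clifford.span_add clifford.span_scale
            clifford.span_base flip: clifford_gen_def)
    qed
  qed (simp_all add: clifford.span_add clifford.span_scale)
  then show ?thesis by auto
qed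

text \<open>Each letter moves the support by one toggle and multiplies the value by a nonzero sign.
  As the letters are distinct, the toggles build up \<open>set xs\<close> from the empty
  set.\<close>

lemma gen_word_act_point:
  assumes "distinct xs"
  shows "\<exists>a::'a::field. a \<noteq> 0 \<and> clifford_act (gen_word xs) (\<lambda>K. if K = {} then 1 else 0)
    = (\<lambda>K. if K = set xs then a else 0)"
  using assms
proof (induction xs)
  case Nil
  show ?case by (intro exI[of _ 1]) (auto simp: gen_word_simps clifford_act_simps)
next
  case (Cons x xs)
  then obtain a :: 'a where a: "a \<noteq> 0" "clifford_act (gen_word xs) (\<lambda>K. if K = {} then 1 else 0)
    = (\<lambda>K. if K = set xs then a else 0)"
    by auto
  have "toggle x K = set xs \<longleftrightarrow> K = set (x # xs)" for K
    using Cons.prems toggle_toggle[of x K] by (auto simp: toggle_def)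
  then have "clifford_act (gen_word (x # xs)) (\<lambda>K. if K = {} then 1 else 0)
    = (\<lambda>K. if K = set (x # xs) then act_sign x K * a else 0)"
    by (auto simp: gen_word_simps clifford_act_simps a clifford_gen_def clifford_act_vec
        letter_act_def)
  also have "\<dots> = (\<lambda>K. if K = set (x # xs) then act_sign x (set (x # xs)) * a else 0)"
    by auto
  finally have "clifford_act (gen_word (x # xs)) (\<lambda>K. if K = {} then 1 else 0)
    = (\<lambda>K. if K = set (x # xs) then act_sign x (set (x # xs)) * a else 0)" .
  moreover have "act_sign x (set (x # xs)) * a \<noteq> 0"
    using a by (simp add: act_sign_def)
  ultimately show ?case by blast
qed

text \<open>Applying the relation to the point mass at the empty set and evaluating at
  \<open>J\<close> leaves only the term \<open>I = J\<close>, a nonzero multiple of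
  \<open>u J\<close>.\<close>

lemma basis_word_combination_eq_0:
  assumes "(\<Sum>I\<in>UNIV. clifford_scale (u I) (basis_word I))
    = (0 :: ('a::field, 'r::finite, 's::finite) clifford)"
  shows "u J = 0"
proof -
  let ?d = "\<lambda>K. if K = {} then 1 else 0 :: 'a"
  have zero: "clifford_act 0 f K = 0" for f :: "('r + 's) set \<Rightarrow> 'a" and K
    using clifford_act_simps(4)[of 0 0 f K] by simp
  have act_sum: "clifford_act (\<Sum>I\<in>A. x I) f K = (\<Sum>I\<in>A. clifford_act (x I) f K)"
    for A f K and x :: "('r + 's) set \<Rightarrow> ('a, 'r, 's) clifford"
    by (induction A rule: infinite_finite_induct) (simp_all add: zero clifford_act_simps)
  have "\<forall>I. \<exists>a. a \<noteq> 0 \<and> clifford_act (basis_word I :: ('a, 'r, 's) clifford) ?d = (\<lambda>K. if K = I then a else 0)"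
  proof
    fix I :: "('r + 's) set"
    show "\<exists>a. a \<noteq> 0 \<and> clifford_act (basis_word I :: ('a, 'r, 's) clifford) ?d = (\<lambda>K. if K = I then a else 0)"
      using gen_word_act_point[of "filter (\<lambda>j. j \<in> I) all_letters"]
      by (simp add: all_letters basis_word_def)
  qed
  then obtain a where a: "\<And>I. a I \<noteq> 0"
      "\<And>I. clifford_act (basis_word I :: ('a, 'r, 's) clifford) ?d = (\<lambda>K. if K = I then a I else 0)"
    by metis
  have "0 = (\<Sum>I\<in>UNIV. u I * (if J = I then a I else 0))"
    using arg_cong[OF assms, of "\<lambda>x. clifford_act x ?d J"]
    by (simp add: zero act_sum clifford_act_simps a)
  also have "\<dots> = (\<Sum>I\<in>UNIV. if J = I then u I * a I else 0)"
    by (rule sum.cong) auto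
  also have "\<dots> = u J * a J" by simp
  finally show ?thesis using a by simp
qed

lemma inj_basis_word: "inj (basis_word :: _ \<Rightarrow> ('a::field, 'r::finite, 's::finite) clifford)"
proof (rule injI, rule ccontr)
  fix I J :: "('r + 's) set"
  assume eq: "basis_word I = (basis_word J :: ('a, 'r, 's) clifford)" and "I \<noteq> J"
  \<comment> \<open>A coincidence of two basis words is a relation with coefficients 1 and
    -1.\<close>
  let ?u = "\<lambda>K. (if K = I then 1 else 0) - (if K = J then 1 else 0) :: 'a"
  have if_scale: "clifford_scale (if b then 1 else 0) x = (if b then x else 0)"
    for b and x :: "('a, 'r, 's) clifford" by simp
  have "(\<Sum>K\<in>UNIV. clifford_scale (?u K) (basis_word K))
      = (basis_word I - basis_word J :: ('a, 'r, 's) clifford)"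
    by (simp only: clifford.scale_left_diff_distrib sum_subtractf if_scale) simp
  then have "?u I = 0" using basis_word_combination_eq_0[of ?u I] eq by simp
  then show False using \<open>I \<noteq> J\<close> by simp
qed

lemma independent_basis_word:
  "clifford.independent (range (basis_word :: _ \<Rightarrow> ('a::field, 'r::finite, 's::finite) clifford))"
proof -
  have "u v = 0" if "(\<Sum>v\<in>range basis_word. clifford_scale (u v) v) = 0" "v \<in> range basis_word"
    for u and v :: "('a, 'r, 's) clifford"
    using that basis_word_combination_eq_0[of "u \<circ> basis_word"]
    by (auto simp: sum.reindex[OF inj_basis_word])
  then show ?thesis by (auto simp: clifford.dependent_finite)
qed

lemma clifford_basis_expansion:
  fixes x :: "('a::field, 'r::finite, 's::finite) clifford"
  obtains u where "x = (\<Sum>I\<in>UNIV. clifford_scale (u I) (basis_word I))"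
proof -
  have "x \<in> clifford.span (range basis_word)" by (simp add: span_basis_word)
  then obtain u where "x = (\<Sum>v\<in>range basis_word. clifford_scale (u v) v)"
    by (auto simp: clifford.span_finite)
  then have "x = (\<Sum>I\<in>UNIV. clifford_scale ((u \<circ> basis_word) I) (basis_word I))"
    by (simp add: sum.reindex[OF inj_basis_word])
  then show thesis by (rule that)
qed

section \<open>Eigenspaces of the two maps\<close>

text \<open>This is (-1)^(k(k+1)/2): k signs from negating the letters and k(k-1)/2 transpositions
  from reversing them.\<close>

definition rev_sign :: "nat \<Rightarrow> 'a::ring_1" where
  "rev_sign k = (if k mod 4 \<in> {1, 2} then - 1 else 1)"

lemma rev_sign_Suc: "rev_sign (Suc k) = - ((- 1) ^ k * rev_sign k)"
proof -
  have "k mod 4 < 4" by simp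
  then consider "k mod 4 = 0" | "k mod 4 = 1" | "k mod 4 = 2" | "k mod 4 = 3" by linarith
  moreover have "even k \<longleftrightarrow> k mod 4 \<in> {0, 2}"
    using \<open>k mod 4 < 4\<close> by simp presburger
  ultimately show ?thesis
    by cases (simp_all add: rev_sign_def mod_Suc uminus_power_if)
qed

lemma gen_word_commute:
  "x \<notin> set xs \<Longrightarrow> gen_word xs * clifford_gen x
    = (clifford_scale ((- 1) ^ length xs) (clifford_gen x * gen_word xs)
       :: ('a::field, 'r::finite, 's::finite) clifford)"
proof (induction xs)
  case (Cons y ys)
  then have "gen_word (y # ys) * clifford_gen x
      = (clifford_scale ((- 1) ^ length ys) (clifford_gen y * clifford_gen x * gen_word ys)
         :: ('a, 'r, 's) clifford)"
    by (simp add: gen_word_simps mult.assoc clifford_scale_mult)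
  also have "clifford_gen y * clifford_gen x
      = (- (clifford_gen x * clifford_gen y) :: ('a, 'r, 's) clifford)"
    using Cons.prems by (intro clifford_gen_anticommute) auto
  finally show ?case by (simp add: gen_word_simps mult.assoc)
qed (simp add: gen_word_simps)

lemma conj_c_hom:
  "Vector_Spaces.linear clifford_scale clifford_scale conj_c"
  "conj_c 1 = 1" "conj_c (x * y) = conj_c y * conj_c x"
  by (metis conj_c(1) clifford_anti_automorphism_def)+

lemma beta_hom:
  "Vector_Spaces.linear clifford_scale clifford_scale beta"
  "beta 1 = 1" "beta (x * y) = beta x * beta y"
  by (metis beta(1) clifford_automorphism_def)+

lemma conj_c_clifford_gen: "conj_c (clifford_gen k) = - clifford_gen k"
  by (simp add: clifford_gen_def conj_c(2))

lemma beta_clifford_gen: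
  "beta (clifford_gen k) = clifford_scale (if isl k then 1 else - 1) (clifford_gen k)"
  by (cases k) (use beta(2,3) in \<open>simp_all add: clifford_gen_def pos_basis_def neg_basis_def\<close>)

text \<open>The map reverses the product, leaving the negated first letter at the end. Bringing it
  back to the front past \<open>length xs\<close> distinct letters gives the recursion
  \<open>rev_sign_Suc\<close>.\<close>

lemma conj_c_gen_word:
  "distinct xs \<Longrightarrow> conj_c (gen_word xs) = clifford_scale (rev_sign (length xs)) (gen_word xs)"
proof (induction xs)
  case Nil
  show ?case
    by (simp add: gen_word_simps conj_c_hom rev_sign_def)
next
  case (Cons x xs)
  then show ?case
    by (simp add: conj_c_hom(3) conj_c_clifford_gen clifford_scale_mult gen_word_commute rev_sign_Suc gen_word_simps mult.commute)
qed

lemma beta_gen_word: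
  "beta (gen_word xs) = clifford_scale ((- 1) ^ length (filter (Not \<circ> isl) xs)) (gen_word xs)"
  by (induction xs)
    (simp_all add: gen_word_simps beta_hom beta_clifford_gen clifford_scale_mult)

lemma length_filter_all_letters: "length (filter P all_letters) = card {j. P j}"
  by (metis all_letters distinct_length_filter Int_UNIV_right)

lemma conj_c_basis_word: "conj_c (basis_word I) = clifford_scale (rev_sign (card I)) (basis_word I)"
  by (simp add: basis_word_def conj_c_gen_word all_letters length_filter_all_letters)

lemma beta_basis_word:
  "beta (basis_word I) = clifford_scale ((- 1) ^ card {j \<in> I. \<not> isl j}) (basis_word I)"
  by (simp add: basis_word_def beta_gen_word length_filter_all_letters)

section \<open>The common eigenspace and its dimension\<close>

lemma linear_sum_eigen:
  fixes f :: "('a::field, 'r::finite, 's::finite) clifford \<Rightarrow> _"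
  assumes "Vector_Spaces.linear clifford_scale clifford_scale f"
    and "\<And>I. f (basis_word I) = clifford_scale (e I) (basis_word I)"
  shows "f (\<Sum>I\<in>UNIV. clifford_scale (u I) (basis_word I))
    = (\<Sum>I\<in>UNIV. clifford_scale (u I * e I) (basis_word I))"
proof -
  interpret f: Vector_Spaces.linear clifford_scale clifford_scale f by (rule assms(1))
  show ?thesis by (simp add: f.sum f.scale assms(2))
qed

text \<open>The vector \<open>f x + x\<close> vanishes and has coefficients
  \<open>u I * (e I + 1)\<close>, so independence applies.\<close>

lemma minus_one_eigenspace_coeff:
  fixes f :: "('a::field, 'r::finite, 's::finite) clifford \<Rightarrow> _"
  assumes "Vector_Spaces.linear clifford_scale clifford_scale f"
    and "\<And>I. f (basis_word I) = clifford_scale (e I) (basis_word I)"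
    and "x = (\<Sum>I\<in>UNIV. clifford_scale (u I) (basis_word I))"
    and "f x = - x"
  shows "u I * (e I + 1) = 0"
proof -
  have "(\<Sum>I\<in>UNIV. clifford_scale (u I * (e I + 1)) (basis_word I)) = f x + x"
    by (simp add: assms(3) linear_sum_eigen[OF assms(1,2)] distrib_left
        clifford.scale_left_distrib sum.distrib)
  then show ?thesis
    using assms(4) basis_word_combination_eq_0[of "\<lambda>I. u I * (e I + 1)"] by simp
qed

definition P_index :: "('r + 's) set set" where
  "P_index = {I. card I mod 4 \<in> {1, 2} \<and> odd (card {j \<in> I. \<not> isl j})}"

lemma P_space_eq_span:
  assumes "(2 :: 'a::field) \<noteq> 0"
  shows "P_space = clifford.span (basis_word ` P_index :: ('a, 'r::finite, 's::finite) clifford set)"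
proof
  have lin: "Vector_Spaces.linear clifford_scale clifford_scale (conj_c :: ('a, 'r, 's) clifford \<Rightarrow> _)"
      "Vector_Spaces.linear clifford_scale clifford_scale (beta :: ('a, 'r, 's) clifford \<Rightarrow> _)"
    by (rule conj_c_hom beta_hom)+
  have two: "(1 + 1 :: 'a) \<noteq> 0" using assms by simp
  show "P_space \<subseteq> clifford.span (basis_word ` P_index :: ('a, 'r, 's) clifford set)"
  proof
    fix x :: "('a, 'r, 's) clifford"
    assume "x \<in> P_space"
    then have x: "conj_c x = - x" "beta x = - x"
      by (auto simp: P_space_def G_space_def)
    obtain u where u: "x = (\<Sum>I\<in>UNIV. clifford_scale (u I) (basis_word I))"
      by (rule clifford_basis_expansion)
    have "u I * (rev_sign (card I) + 1) = 0" "u I * ((- 1) ^ card {j \<in> I. \<not> isl j} + 1) = 0" for I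
      using minus_one_eigenspace_coeff[OF lin(1) conj_c_basis_word u x(1)]
        minus_one_eigenspace_coeff[OF lin(2) beta_basis_word u x(2)] by auto
    \<comment> \<open>Outside \<open>P_index\<close> at least one of the two eigenvalues is 1; the
      factor 2 is where the characteristic enters.\<close>
    then have "u I * (1 + 1) = 0" if "I \<notin> P_index" for I
      using that unfolding P_index_def rev_sign_def uminus_power_if
      by (smt (verit) mem_Collect_eq power_one)
    then have "u I = 0" if "I \<notin> P_index" for I
      using that two by (metis mult_eq_0_iff)
    then have "clifford_scale (u I) (basis_word I)
        \<in> clifford.span (basis_word ` P_index :: ('a, 'r, 's) clifford set)" for I
      by (cases "I \<in> P_index") (auto intro: clifford.span_scale clifford.span_base clifford.span_zero)
    then show "x \<in> clifford.span (basis_word ` P_index)"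
      unfolding u by (intro clifford.span_sum)
  qed
  have "clifford.subspace (P_space :: ('a, 'r, 's) clifford set)"
  proof -
    interpret c: Vector_Spaces.linear clifford_scale clifford_scale "conj_c :: ('a, 'r, 's) clifford \<Rightarrow> _"
      by (rule lin)
    interpret b: Vector_Spaces.linear clifford_scale clifford_scale "beta :: ('a, 'r, 's) clifford \<Rightarrow> _"
      by (rule lin)
    show ?thesis
      by (auto simp: clifford.subspace_def P_space_def G_space_def c.zero b.zero c.add b.add
          c.scale b.scale)
  qed
  moreover have "basis_word ` P_index \<subseteq> (P_space :: ('a, 'r, 's) clifford set)"
    by (auto simp: P_index_def P_space_def G_space_def conj_c_basis_word beta_basis_word rev_sign_def)
  ultimately show "clifford.span (basis_word ` P_index :: ('a, 'r, 's) clifford set) \<subseteq> P_space"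
    by (rule clifford.span_minimal[rotated])
qed

lemma dim_P_space:
  assumes "(2 :: 'a::field) \<noteq> 0"
  shows "clifford.dim (P_space :: ('a, 'r::finite, 's::finite) clifford set)
    = card (P_index :: ('r + 's) set set)"
proof -
  have "clifford.independent (basis_word ` P_index :: ('a, 'r, 's) clifford set)"
    by (rule clifford.independent_mono[OF independent_basis_word]) auto
  then have "clifford.dim (P_space :: ('a, 'r, 's) clifford set)
      = card (basis_word ` P_index :: ('a, 'r, 's) clifford set)"
    by (simp add: P_space_eq_span[OF assms] clifford.dim_eq_card_independent)
  then show ?thesis
    by (simp add: card_image inj_on_subset[OF inj_basis_word])
qed

section \<open>Counting the basis elements\<close>

text \<open>Expand the product over all letters of 1 plus a weight, the weight being
  \<open>z\<close> on the first r letters and \<open>z * w\<close> on the last s.\<close>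

lemma sum_powers_over_subsets:
  fixes z w :: "'b::comm_ring_1"
  shows "(\<Sum>I\<in>(UNIV :: ('r::finite + 's::finite) set set). z ^ card I * w ^ card {j \<in> I. \<not> isl j})
    = (1 + z) ^ CARD('r) * (1 + z * w) ^ CARD('s)"
proof -
  let ?f = "\<lambda>k :: 'r + 's. if isl k then z else z * w"
  have "{j \<in> insert x I. \<not> isl j} = (if isl x then {j \<in> I. \<not> isl j} else insert x {j \<in> I. \<not> isl j})"
    for x and I :: "('r + 's) set" by auto
  then have "(\<Prod>k\<in>I. ?f k) = z ^ card I * w ^ card {j \<in> I. \<not> isl j}"
    for I :: "('r + 's) set"
    by (induction I rule: infinite_finite_induct) (simp_all add: mult_ac)
  then have "(\<Sum>I\<in>(UNIV :: ('r + 's) set set). z ^ card I * w ^ card {j \<in> I. \<not> isl j}) = (\<Sum>I\<in>Pow UNIV. \<Prod>k\<in>I. ?f k)"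
    by simp
  also have "\<dots> = (\<Prod>k\<in>UNIV. ?f k + 1)"
    by (subst prod_add) simp_all
  also have "\<dots> = (\<Prod>k\<in>UNIV <+> UNIV. ?f k + 1)" by simp
  also have "\<dots> = (1 + z) ^ CARD('r) * (1 + z * w) ^ CARD('s)"
    by (subst prod.Plus) (simp_all add: add.commute)
  finally show ?thesis .
qed

text \<open>Powers of \<i> rotate 1 + \<i> through the four points with coordinates 1 or -1, whose
  real parts are 1, -1, -1, 1 in turn.\<close>

lemma rev_sign_eq_Re: "rev_sign k = Re ((1 + \<i>) * \<i> ^ k)"
proof -
  \<comment> \<open>The imaginary part is carried along because multiplication by \<i> turns its
    negative into the next real part.\<close>
  have "rev_sign k = Re ((1 + \<i>) * \<i> ^ k) \<and> (- 1) ^ k * rev_sign k = Im ((1 + \<i>) * \<i> ^ k)"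
    by (induction k) (auto simp: rev_sign_Suc rev_sign_def[of 0] uminus_power_if)
  then show ?thesis by simp
qed

lemma one_plus_i_power: "(1 + \<i>) ^ n = rcis (sqrt 2 ^ n) (real n * pi / 4)"
  "(1 - \<i>) ^ n = rcis (sqrt 2 ^ n) (- (real n * pi / 4))"
proof -
  have "1 + \<i> = rcis (sqrt 2) (pi / 4)" "1 - \<i> = rcis (sqrt 2) (- (pi / 4))"
    by (simp_all add: complex_eq_iff cos_45 sin_45)
  then show "(1 + \<i>) ^ n = rcis (sqrt 2 ^ n) (real n * pi / 4)"
    "(1 - \<i>) ^ n = rcis (sqrt 2 ^ n) (- (real n * pi / 4))"
    by (simp_all add: DeMoivre2)
qed

text \<open>Four times the indicator of \<open>P_index\<close> is a product of two factors 1 minus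
  an eigenvalue; multiplied out, it yields four sums of the form
  \<open>sum_powers_over_subsets\<close>.\<close>

lemma card_P_index:
  "4 * real (card (P_index :: ('r::finite + 's::finite) set set))
    = 2 ^ (CARD('r) + CARD('s)) + 2 * sqrt 2 ^ (CARD('r) + 1 + CARD('s)) *
        sin ((real CARD('r) + 1) * pi / 4) * sin (real CARD('s) * pi / 4)"
proof -
  let ?r = "CARD('r)" and ?s = "CARD('s)"
  let ?b = "\<lambda>I :: ('r + 's) set. card {j \<in> I. \<not> isl j}"
  have "4 * real (card (P_index :: ('r + 's) set set))
      = (\<Sum>I\<in>UNIV. if I \<in> (P_index :: ('r + 's) set set) then 4 else 0)"
    by (simp add: sum.If_cases)
  also have "\<dots> = (\<Sum>I\<in>UNIV. Re ((1 - (1 + \<i>) * \<i> ^ card I) * (1 - (- 1) ^ ?b I)))"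
  proof (rule sum.cong)
    fix I :: "('r + 's) set"
    have "Re ((1 - (1 + \<i>) * \<i> ^ card I) * (1 - (- 1) ^ ?b I))
        = (1 - rev_sign (card I)) * (1 - (- 1) ^ ?b I)"
      unfolding rev_sign_eq_Re by (simp add: uminus_power_if)
    also have "\<dots> = (if I \<in> P_index then 4 else 0)"
      by (simp add: P_index_def rev_sign_def uminus_power_if)
    finally show "(if I \<in> P_index then 4 else 0)
        = Re ((1 - (1 + \<i>) * \<i> ^ card I) * (1 - (- 1) ^ ?b I))" by simp
  qed simp
  \<comment> \<open>The powers of 1 are written out so that each term matches with \<open>z\<close>
    in {1, \<i>} and \<open>w\<close> in {1, -1}.\<close>
  also have "\<dots> = Re (\<Sum>I\<in>UNIV. 1 ^ card I * 1 ^ ?b I - 1 ^ card I * (- 1) ^ ?b I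
      - (1 + \<i>) * (\<i> ^ card I * 1 ^ ?b I) + (1 + \<i>) * (\<i> ^ card I * (- 1) ^ ?b I))"
    unfolding Re_sum by (rule sum.cong) (simp_all add: algebra_simps)
  \<comment> \<open>The sum for \<open>z = 1\<close>, \<open>w = -1\<close> has the factor
    \<open>0 ^ ?s\<close> and vanishes since s is positive. The exponent r + 1 absorbs the prefactor
    1 + \<i>.\<close>
  also have "\<dots> = Re (2 ^ (?r + ?s) - (1 + \<i>) ^ (?r + 1) * (1 + \<i>) ^ ?s
      + (1 + \<i>) ^ (?r + 1) * (1 - \<i>) ^ ?s)"
    by (rule arg_cong[where f = Re], simp only: sum.distrib sum_subtractf sum_powers_over_subsets
          flip: sum_distrib_left) (simp add: power_add zero_power mult_ac)
  also have "\<dots> = 2 ^ (?r + ?s) + sqrt 2 ^ (?r + 1 + ?s) *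
      (cos ((real ?r + 1) * pi / 4 - real ?s * pi / 4) - cos ((real ?r + 1) * pi / 4 + real ?s * pi / 4))"
    by (simp only: one_plus_i_power rcis_mult)
      (simp add: power_add algebra_simps)
  \<comment> \<open>This is cos(A - B) - cos(A + B) = 2 sin A sin B.\<close>
  also have "\<dots> = 2 ^ (?r + ?s) + 2 * sqrt 2 ^ (?r + 1 + ?s) *
      sin ((real ?r + 1) * pi / 4) * sin (real ?s * pi / 4)"
    unfolding cos_add cos_diff by (simp add: algebra_simps)
  finally show ?thesis .
qed

theorem proposition2p12:
  fixes r s dimP :: nat
  assumes "CHAR('a::field) \<noteq> 2"
    and "r = CARD('r::finite)" and "s = CARD('s::finite)"
    and "dimP = vector_space.dim clifford_scale (P_space :: ('a, 'r, 's) clifford set)"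
  shows
    "(r \<ge> 3 \<and> s \<ge> 3 \<longrightarrow>
        real dimP = 2 ^ (r + s - 2) + 2 powr ((real r + real s - 1) / 2) *
          sin ((real r + 1) * pi / 4) * sin (real s * pi / 4)) \<and>
     (r \<ge> 3 \<longrightarrow>
        (s = 1 \<longrightarrow>
          real dimP = 2 ^ (r - 1) + 2 powr ((real r - 1) / 2) * sin ((real r + 1) * pi / 4)) \<and>
        (s = 2 \<longrightarrow>
          real dimP = 2 ^ r + 2 powr ((real r + 1) / 2) * sin ((real r + 1) * pi / 4))) \<and>
     (s \<ge> 3 \<longrightarrow>
        (r = 1 \<longrightarrow>
          real dimP = 2 ^ (s - 1) + 2 powr (real s / 2) * sin (real s * pi / 4)) \<and>
        (r = 2 \<longrightarrow>
          real dimP = 2 ^ s + 2 powr (real s / 2) * sin (real s * pi / 4))) \<and>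
     (r = 1 \<and> s = 1 \<longrightarrow> dimP = 2) \<and>
     (r = 1 \<and> s = 2 \<longrightarrow> dimP = 4) \<and>
     (r = 2 \<and> s = 1 \<longrightarrow> dimP = 3) \<and>
     (r = 2 \<and> s = 2 \<longrightarrow> dimP = 6)"
proof -
  \<comment> \<open>The only divisors of 2 are 1 and 2, and a field does not have characteristic
    1.\<close>
  have "\<not> CHAR('a) dvd 2"
    using assms(1) CHAR_not_1[where ?'a = 'a] prime_nat_iff[of 2] by auto
  then have "(2 :: 'a) \<noteq> 0"
    using of_nat_eq_0_iff_char_dvd[of 2, where ?'a = 'a] by simp
  then have "dimP = card (P_index :: ('r + 's) set set)"
    using assms(4) dim_P_space by simp
  then have dim4: "4 * real dimP = 2 ^ (r + s) + 2 * sqrt 2 ^ (r + 1 + s) *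
      sin ((real r + 1) * pi / 4) * sin (real s * pi / 4)"
    using card_P_index[where ?'r = 'r and ?'s = 's] assms(2,3) by simp
  \<comment> \<open>Positivity makes the natural subtraction in \<open>r + s - 2\<close>
    exact.\<close>
  have "r > 0" "s > 0" by (simp_all add: assms)
  then have "(2::real) ^ (r + s) = 4 * 2 ^ (r + s - 2)"
    by (cases r; cases s) simp_all
  moreover have "2 * sqrt 2 ^ (r + 1 + s) = 4 * 2 powr ((real r + real s - 1) / 2)"
  proof -
    have "sqrt 2 ^ (r + 1 + s) = 2 powr (1 + (real r + real s - 1) / 2)"
      by (simp add: powr_half_sqrt[symmetric] powr_realpow[symmetric] powr_powr add_ac
          add_divide_distrib diff_divide_distrib powr_add)
    then show ?thesis by (simp add: powr_add)
  qed
  \<comment> \<open>Dividing by 4 gives the general formula for all positive r and s; the remaining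
    cases evaluate its sines.\<close>
  ultimately have dim: "real dimP = 2 ^ (r + s - 2) + 2 powr ((real r + real s - 1) / 2) *
      sin ((real r + 1) * pi / 4) * sin (real s * pi / 4)"
    using dim4 by simp
  have sin135: "sin (3 * pi / 4) = sqrt 2 / 2"
    using sin_pi_minus[of "pi / 4"] by (simp add: sin_45 field_simps)
  \<comment> \<open>For s = 1 or r = 2 one sine equals \<open>sqrt 2 / 2\<close> and lowers the
    exponent by one half.\<close>
  have half: "2 powr (x + 1 / 2) * (sqrt 2 / 2) = 2 powr x" for x :: real
    by (simp add: powr_add powr_half_sqrt)
  show ?thesis
  proof (intro conjI impI)
    show "real dimP = 2 ^ (r - 1) + 2 powr ((real r - 1) / 2) * sin ((real r + 1) * pi / 4)"
      if "s = 1"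
      using dim half[of "(real r - 1) / 2"] that
      by (simp add: sin_45 diff_divide_distrib algebra_simps)
    show "real dimP = 2 ^ r + 2 powr ((real r + 1) / 2) * sin ((real r + 1) * pi / 4)"
      if "s = 2"
      using dim that by (simp add: add.commute)
    show "real dimP = 2 ^ (s - 1) + 2 powr (real s / 2) * sin (real s * pi / 4)"
      if "r = 1"
      using dim that by simp
    show "real dimP = 2 ^ s + 2 powr (real s / 2) * sin (real s * pi / 4)"
      if "r = 2"
      using dim half[of "real s / 2"] that
      by (simp add: sin135[unfolded mult.commute[of 3 pi]] add_divide_distrib algebra_simps)
    \<comment> \<open>The four smallest cases start from \<open>dim4\<close>, whose natural powers
      of \<open>sqrt 2\<close> can be evaluated directly.\<close>
    show "dimP = 2" if "r = 1 \<and> s = 1"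
      using dim4 that by (simp add: sin_45 power_numeral_reduce)
    show "dimP = 4" if "r = 1 \<and> s = 2"
      using dim4 that by (simp add: power_numeral_reduce)
    show "dimP = 3" if "r = 2 \<and> s = 1"
      using dim4 that by (simp add: sin_45 sin135 power_numeral_reduce)
    show "dimP = 6" if "r = 2 \<and> s = 2"
      using dim4 that by (simp add: sin135 power_numeral_reduce)
  qed (use dim in simp)
qed

end
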